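(* (1) For all integers $n\ge0$, $c_n<b_{n+1}$. (2) $A_{2n+1}$ is strictly increasing and $A_{2n}$ is strictly decreasing in the integer $n\ge1$, and for all integers $n\ge1$, $$a_{2n+2}<A_{2n+1}<\lim_{m\to\infty}A_m=0<a_{2n+1}+\tfrac12a_{2n+2}<A_{2n}<a_{2n+1}.$$ (3) $|a_n|$ is strictly decreasing in the integer $n\ge2$. In particular, for integers $n\ge2$ and $\mu=65/108=0.601851\cdots$, $$\lim_{m\to\infty}a_m=0<-a_{2n+2}<a_{2n+1}<-a_{2n}<\cdots<a_3<a_2<-a_1,$$ $$\left(1-\frac{1-\mu}{2^{n-1}-\mu}\right)\zeta(n)<\zeta(n+1)<\frac{\zeta(n)+1}{2}<\zeta(n).$$
   Context: Let $\zeta$ be the Riemann zeta function, $\lambda(n)=\sum_{k=0}^\infty (2k+1)^{-n}$ ($n\ge2$), $\eta(n)=\sum_{k=1}^\infty(-1)^{k-1}k^{-n}$ and $\beta(n)=\sum_{k=0}^\infty(-1)^k(2k+1)^{-n}$ ($n\ge 1$). Constants: $a_0=1$, $a_1=-2\eta(2)-1=-1-\pi^2/6$, $a_2=2\zeta(3)$, and for $n\ge3$, $$a_n=[1+(-1)^n][\zeta(n+1)-\zeta(n-1)]+[1-(-1)^n][\zeta(n)-\eta(n+1)];$$ $b_0=5\log2-\pi$, $b_1=-\log2+[35\zeta(3)-\pi^3]/8$, and $b_n=5\lambda(2n+1)-\lambda(2n-1)-4\beta(2n+1)$ for $n\ge2$; and for $n\ge0$, $$c_n=1-\sum_{k=0}^nb_k,\qquad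 A_n=2^{n+1}\Big(b_0-\sum_{k=0}^n2^{-k}a_k\Big).$$ *)

theory Defs
  imports "HOL-Analysis.Analysis"
begin

(* The Riemann zeta function occurs below only at integer arguments n >= 2, where it is
   given by its absolutely convergent Dirichlet series; other arguments are junk values. *)
definition zeta :: "nat \<Rightarrow> real" where
  "zeta n = (\<Sum>k. 1 / real (Suc k) ^ n)"

definition dirichlet_lambda :: "nat \<Rightarrow> real" where
  "dirichlet_lambda n = (\<Sum>k. 1 / real (2 * k + 1) ^ n)"

(* The summation index is shifted by one, so that it starts at 0. *)
definition dirichlet_eta :: "nat \<Rightarrow> real" where
  "dirichlet_eta n = (\<Sum>k. (- 1) ^ k / real (Suc k) ^ n)"

definition dirichlet_beta :: "nat \<Rightarrow> real" where
  "dirichlet_beta n = (\<Sum>k. (- 1) ^ k / real (2 * k + 1) ^ n)"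

(* The natural-number subtractions n - 1 and 2 * n - 1 below never truncate:
   they are only reached for n >= 3 and n >= 2. *)
definition a_seq :: "nat \<Rightarrow> real" where
  "a_seq n =
    (if n = 0 then 1
     else if n = 1 then - 2 * dirichlet_eta 2 - 1
     else if n = 2 then 2 * zeta 3
     else (1 + (- 1) ^ n) * (zeta (n + 1) - zeta (n - 1))
        + (1 - (- 1) ^ n) * (zeta n - dirichlet_eta (n + 1)))"

definition b_seq :: "nat \<Rightarrow> real" where
  "b_seq n =
    (if n = 0 then 5 * ln 2 - pi
     else if n = 1 then - ln 2 + (35 * zeta 3 - pi ^ 3) / 8
     else 5 * dirichlet_lambda (2 * n + 1) - dirichlet_lambda (2 * n - 1)
        - 4 * dirichlet_beta (2 * n + 1))"

definition c_seq :: "nat \<Rightarrow> real" where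
  "c_seq n = 1 - (\<Sum>k=0..n. b_seq k)"

definition A_seq :: "nat \<Rightarrow> real" where
  "A_seq n = 2 ^ (n + 1) * (b_seq 0 - (\<Sum>k=0..n. a_seq k / 2 ^ k))"

end

theory Submission
  imports Defs "HOL-Real_Asymp.Real_Asymp"
begin

text \<open>
  Writing the constants as sums over k and summing the resulting geometric series in n first
  turns both generating series into rational series in k, which reduce to the series of ln 2
  and pi: the b_n sum to 1, and the a_n / 2^n sum to b_0. The first identity also needs
  beta(3) = pi^3 / 32, obtained by differentiating the reflection formula of Gamma three times.
  Hence c_n is the tail of the series of b_n, and b_n < 0 for n \<ge> 2 gives part (1). Likewise
  A_n = a_{n+1} + a_{n+2} / 2 + a_{n+3} / 4 + ..., a series with alternating signs; everything in
  parts (2) and (3) about a_n and A_n follows from |a_{2n+2}| < |a_{2n+1}| and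
  2 |a_{2n+3}| < |a_{2n+2}|. The remaining lower bound for zeta(n+1) is numerical for n = 2, 3,
  and for n \<ge> 4 it holds since 2^(n-1) (zeta(n) - zeta(n+1)) decreases in n.
\<close>

section \<open>Comparison, grouping and interchange of real series\<close>

lemma sums_less:
  fixes f g :: "nat \<Rightarrow> real"
  assumes "f sums s" "g sums t" "\<And>k. f k \<le> g k" "f i < g i"
  shows "s < t"
proof -
  have "(\<lambda>k. g k - f k) sums (t - s)"
    by (intro sums_diff assms)
  moreover have "0 < (\<Sum>k. g k - f k)"
    using assms by (intro suminf_pos2[where i=i] sums_summable[OF calculation]) auto
  ultimately show ?thesis
    by (simp add: sums_iff)
qed

lemma sums_shift_one:
  fixes f :: "nat \<Rightarrow> real"
  assumes "f sums s"
  shows "(\<lambda>k. f (Suc k)) sums (s - f 0)"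
  using assms sums_Suc_iff[of f "s - f 0"] by simp

text \<open>Pairing neighbours lets an alternating series be replaced by one whose terms have
  constant sign, so that \<open>sums_less\<close> applies.\<close>

lemma sums_pairs:
  fixes f :: "nat \<Rightarrow> real"
  assumes "f sums s"
  shows "(\<lambda>k. f (2 * k) + f (2 * k + 1)) sums s"
proof -
  have "sum f {k * 2..<k * 2 + 2} = f (2 * k) + f (2 * k + 1)" for k
    by (simp add: numeral_2_eq_2 mult.commute)
  then show ?thesis
    using sums_group[OF assms, of 2] by simp
qed

text \<open>Interchange of the sums over k and m without a double-series theorem: the inner
  geometric sum over m < N is exactly h - h q^N with h = g / (1 - q). Since q is at most 1/2, the
  remainder is at most 2^(-N) times the sum of |h|.\<close>

lemma sums_geometric_swap:
  fixes g q :: "nat \<Rightarrow> real"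
  assumes b: "\<And>m. (\<lambda>k. g k * q k ^ m) sums b m"
    and g: "summable (\<lambda>k. \<bar>g k\<bar>)"
    and q: "\<And>k. 0 \<le> q k" "\<And>k. q k \<le> 1 / 2"
    and s: "(\<lambda>k. g k / (1 - q k)) sums s"
  shows "b sums s"
proof -
  define h where "h k = g k / (1 - q k)" for k
  \<comment> \<open>Because q is at most 1/2, the factor 1 / (1 - q) is at most 2; absolute
    summability passes from g to h.\<close>
  have h_bound: "\<bar>h k\<bar> \<le> 2 * \<bar>g k\<bar>" for k
  proof -
    have "\<bar>g k\<bar> * 1 \<le> \<bar>g k\<bar> * (2 * (1 - q k))"
      using q(2)[of k] by (intro mult_left_mono) auto
    then show ?thesis
      using q(2)[of k] by (simp add: h_def abs_divide field_simps)
  qed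
  have sh: "summable (\<lambda>k. \<bar>h k\<bar>)"
    by (rule summable_comparison_test[OF _ summable_mult[OF g, of 2]]) (use h_bound in auto)
  have bound: "norm (sum b {..<N} - s) \<le> (1 / 2) ^ N * (\<Sum>k. \<bar>h k\<bar>)" for N
  proof -
    have "(\<Sum>m<N. g k * q k ^ m) = h k - h k * q k ^ N" for k
      using q(2)[of k]
      by (simp add: sum_distrib_left[symmetric] sum_gp_strict h_def diff_divide_distrib right_diff_distrib)
    then have "(\<lambda>k. h k - h k * q k ^ N) sums sum b {..<N}"
      using sums_sum[of "{..<N}" "\<lambda>m k. g k * q k ^ m" b] b by simp
    from sums_diff[OF s this] have r: "(\<lambda>k. h k * q k ^ N) sums (s - sum b {..<N})"
      by (simp add: h_def)
    have le: "\<bar>h k * q k ^ N\<bar> \<le> (1 / 2) ^ N * \<bar>h k\<bar>" for k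
    proof -
      have "q k ^ N \<le> (1 / 2) ^ N" using q by (intro power_mono)
      then have "\<bar>h k\<bar> * q k ^ N \<le> \<bar>h k\<bar> * (1 / 2) ^ N"
        by (intro mult_left_mono) auto
      then show ?thesis using q(1)[of k] by (simp add: abs_mult mult.commute)
    qed
    have "summable (\<lambda>k. \<bar>h k * q k ^ N\<bar>)"
      by (rule summable_comparison_test[OF _ summable_mult[OF sh, of "(1/2)^N"]]) (use le in auto)
    then have "\<bar>s - sum b {..<N}\<bar> \<le> (\<Sum>k. \<bar>h k * q k ^ N\<bar>)"
      using summable_rabs[of "\<lambda>k. h k * q k ^ N"] r by (simp add: sums_iff)
    also have "\<dots> \<le> (\<Sum>k. (1 / 2) ^ N * \<bar>h k\<bar>)"
      using le \<open>summable (\<lambda>k. \<bar>h k * q k ^ N\<bar>)\<close> by (intro suminf_le summable_mult sh)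
    also have "\<dots> = (1 / 2) ^ N * (\<Sum>k. \<bar>h k\<bar>)"
      by (rule suminf_mult[OF sh])
    finally show ?thesis by (simp add: abs_minus_commute)
  qed
  have "(\<lambda>N. (1 / 2) ^ N * (\<Sum>k. \<bar>h k\<bar>)) \<longlonglongrightarrow> 0"
    by (intro tendsto_mult_left_zero LIMSEQ_realpow_zero) auto
  then have "(\<lambda>N. sum b {..<N} - s) \<longlonglongrightarrow> 0"
    by (rule Lim_null_comparison[OF always_eventually[OF allI[OF bound]]])
  then show ?thesis
    unfolding sums_def by (simp add: LIM_zero_iff)
qed

subsection \<open>Reflection of the polygamma functions and the value of beta(3)\<close>

text \<open>The complex reflection formula is carried over to the reals, where all factors are
  positive on (0, 1). The logarithmic form is chosen because its derivatives are the polygamma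
  functions.\<close>

lemma ln_Gamma_reflection:
  fixes x :: real
  assumes "0 < x" "x < 1"
  shows "ln_Gamma x + ln_Gamma (1 - x) = ln pi - ln (sin (pi * x))"
proof -
  have "complex_of_real (Gamma x * Gamma (1 - x)) = complex_of_real (pi / sin (pi * x))"
    using Gamma_reflection_complex[of "of_real x"]
    by (metis Gamma_complex_of_real of_real_1 of_real_diff of_real_divide of_real_mult sin_of_real)
  then have "Gamma x * Gamma (1 - x) = pi / sin (pi * x)"
    using of_real_eq_iff by blast
  moreover have "0 < sin (pi * x)"
    using assms by (intro sin_gt_zero) auto
  ultimately show ?thesis
    using assms ln_mult_pos[of "Gamma x" "Gamma (1 - x)"] ln_div[of pi "sin (pi * x)"]
    by (simp add: ln_Gamma_real_pos Gamma_real_pos)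
qed

lemma not_nonpos_Int_pos: "0 < x \<Longrightarrow> (x::real) \<notin> \<int>\<^sub>\<le>\<^sub>0"
  by (auto elim!: nonpos_Ints_cases)

text \<open>Lets an identity on (0, 1) be differentiated on both sides, by uniqueness of the
  derivative; each reflection formula below is thus the derivative of the preceding one.\<close>

lemma has_field_derivative_unique_unit_interval:
  fixes f g :: "real \<Rightarrow> real"
  assumes "0 < x" "x < 1" "\<And>y. 0 < y \<Longrightarrow> y < 1 \<Longrightarrow> f y = g y"
    and "(f has_field_derivative f') (at x)" "(g has_field_derivative g') (at x)"
  shows "f' = g'"
proof -
  have "(g has_field_derivative f') (at x)"
    by (rule has_field_derivative_transform_within_open[OF assms(4), of "{0<..<1}"])
       (use assms in auto)
  then show ?thesis
    using assms(5) by (rule DERIV_unique)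
qed

lemma Digamma_reflection:
  fixes x :: real
  assumes "0 < x" "x < 1"
  shows "Digamma x - Digamma (1 - x) = - pi * cos (pi * x) / sin (pi * x)"
proof (rule has_field_derivative_unique_unit_interval[OF assms ln_Gamma_reflection])
  have "0 < sin (pi * x)"
    using assms by (intro sin_gt_zero) auto
  then show "((\<lambda>x. ln pi - ln (sin (pi * x))) has_field_derivative
      - pi * cos (pi * x) / sin (pi * x)) (at x)"
    by (auto intro!: derivative_eq_intros)
  show "((\<lambda>x. ln_Gamma x + ln_Gamma (1 - x)) has_field_derivative Digamma x - Digamma (1 - x)) (at x)"
    using assms by (auto intro!: derivative_eq_intros)
qed

lemma Polygamma_1_reflection:
  fixes x :: real
  assumes "0 < x" "x < 1"
  shows "Polygamma 1 x + Polygamma 1 (1 - x) = pi ^ 2 / sin (pi * x) ^ 2"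
proof (rule has_field_derivative_unique_unit_interval[OF assms Digamma_reflection])
  have s: "0 < sin (pi * x)"
    using assms by (intro sin_gt_zero) auto
  \<comment> \<open>The quotient rule leaves sin^2 + cos^2 in the numerator. The Pythagorean simp
    rules are switched off so that the sum survives until the derivative has been matched; it
    collapses to 1 afterwards.\<close>
  have "((\<lambda>x. - pi * cos (pi * x) / sin (pi * x)) has_field_derivative
      pi ^ 2 * (sin (pi * x) ^ 2 + cos (pi * x) ^ 2) / sin (pi * x) ^ 2) (at x)"
    using s
    by (auto intro!: derivative_eq_intros
        simp del: sin_cos_squared_add sin_cos_squared_add2 sin_cos_squared_add3
        simp: power2_eq_square divide_simps algebra_simps)
  then show "((\<lambda>x. - pi * cos (pi * x) / sin (pi * x)) has_field_derivative
      pi ^ 2 / sin (pi * x) ^ 2) (at x)"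
    by simp
  show "((\<lambda>x. Digamma x - Digamma (1 - x)) has_field_derivative
      Polygamma 1 x + Polygamma 1 (1 - x)) (at x)"
    using assms by (auto intro!: derivative_eq_intros simp: not_nonpos_Int_pos)
qed

lemma Polygamma_2_reflection:
  fixes x :: real
  assumes "0 < x" "x < 1"
  shows "Polygamma 2 x - Polygamma 2 (1 - x) = - 2 * pi ^ 3 * cos (pi * x) / sin (pi * x) ^ 3"
proof (rule has_field_derivative_unique_unit_interval[OF assms Polygamma_1_reflection])
  have s: "0 < sin (pi * x)"
    using assms by (intro sin_gt_zero) auto
  then show "((\<lambda>x. pi ^ 2 / sin (pi * x) ^ 2) has_field_derivative
      - 2 * pi ^ 3 * cos (pi * x) / sin (pi * x) ^ 3) (at x)"
    by (auto intro!: derivative_eq_intros simp: field_simps eval_nat_numeral)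
  show "((\<lambda>x. Polygamma 1 x + Polygamma 1 (1 - x)) has_field_derivative
      Polygamma 2 x - Polygamma 2 (1 - x)) (at x)"
    using assms by (auto intro!: derivative_eq_intros simp: not_nonpos_Int_pos numeral_2_eq_2)
qed

section \<open>Convergence of the Dirichlet series, and the values of beta(3) and lambda(3)\<close>

lemma summable_inverse_odd_power:
  assumes "2 \<le> n"
  shows "summable (\<lambda>k. 1 / real (2 * k + 1) ^ n)"
proof (rule summable_comparison_test)
  show "summable (\<lambda>k. inverse (real (Suc k) ^ n))"
    using inverse_power_summable[OF assms, where 'a=real] by (subst summable_Suc_iff)
  show "\<exists>N. \<forall>k\<ge>N. norm (1 / real (2 * k + 1) ^ n) \<le> inverse (real (Suc k) ^ n)"
    by (intro exI[of _ 0]) (auto simp: field_simps intro!: power_mono)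
qed

lemma summable_inverse_Suc_power:
  assumes "2 \<le> n"
  shows "summable (\<lambda>k. 1 / real (Suc k) ^ n)"
proof -
  have "summable (\<lambda>k. inverse (real (Suc k) ^ n))"
    using inverse_power_summable[OF assms, where 'a=real] by (subst summable_Suc_iff)
  then show ?thesis by (simp add: inverse_eq_divide)
qed

lemma zeta_sums: "2 \<le> n \<Longrightarrow> (\<lambda>k. 1 / real (Suc k) ^ n) sums zeta n"
  unfolding zeta_def by (intro summable_sums summable_inverse_Suc_power)

lemma lambda_sums: "2 \<le> n \<Longrightarrow> (\<lambda>k. 1 / real (2 * k + 1) ^ n) sums dirichlet_lambda n"
  unfolding dirichlet_lambda_def by (intro summable_sums summable_inverse_odd_power)

lemma eta_sums: "2 \<le> n \<Longrightarrow> (\<lambda>k. (- 1) ^ k / real (Suc k) ^ n) sums dirichlet_eta n"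
  unfolding dirichlet_eta_def
  by (rule summable_sums, rule summable_norm_cancel)
     (use summable_inverse_Suc_power[of n] in \<open>simp add: norm_divide norm_power\<close>)

lemma beta_sums: "2 \<le> n \<Longrightarrow> (\<lambda>k. (- 1) ^ k / real (2 * k + 1) ^ n) sums dirichlet_beta n"
  unfolding dirichlet_beta_def
  by (rule summable_sums, rule summable_norm_cancel)
     (use summable_inverse_odd_power[of n] in \<open>simp add: norm_divide norm_power\<close>)

text \<open>Pairing terms splits beta(3) over the residues 1 and 3 modulo 4. Each part is a series 1
  / (4k + x)^3, a multiple of \<open>Polygamma 2\<close> at x/4, and 1/4 and 3/4 are exchanged by
  reflection.\<close>

lemma beta_3: "dirichlet_beta 3 = pi ^ 3 / 32"
proof -
  have cube: "inverse ((x / 4 + real k) ^ Suc 2) = 64 * (1 / (4 * real k + x) ^ 3)" for x :: real and k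
    by (simp add: power_divide inverse_eq_divide field_simps eval_nat_numeral)
  have "(\<lambda>k. inverse ((x / 4 + real k) ^ Suc 2)) sums (- Polygamma 2 (x / 4) / 2)" if "0 < x" for x :: real
    using Polygamma_converges'[of "x/4" "Suc 2"] that
    by (simp add: Polygamma_def sums_iff summable_sums fact_numeral)
  note S = this
  have P: "(\<lambda>k. 1 / (4 * real k + x) ^ 3) sums (- Polygamma 2 (x / 4) / 128)" if "0 < x" for x :: real
    using sums_mult[OF S[OF that, unfolded cube], of "1 / 64"] by simp
  have "(\<lambda>k. 1 / (4 * real k + 1) ^ 3 - 1 / (4 * real k + 3) ^ 3) sums
      (- Polygamma 2 (1 / 4) / 128 - (- Polygamma 2 (3 / 4) / 128))"
    by (intro sums_diff P) auto
  moreover have "(\<lambda>k. 1 / (4 * real k + 1) ^ 3 - 1 / (4 * real k + 3) ^ 3) sums dirichlet_beta 3"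
    using sums_pairs[OF beta_sums[of 3]] by (simp add: algebra_simps)
  ultimately have "dirichlet_beta 3 = - Polygamma 2 (1 / 4) / 128 - (- Polygamma 2 (3 / 4) / 128)"
    by (intro sums_unique2)
  then have "dirichlet_beta 3 = - (Polygamma 2 (1 / 4) - Polygamma 2 (3 / 4)) / 128"
    by simp
  \<comment> \<open>At x = 1/4 sine and cosine agree, so cos / sin^3 = 1 / sin^2 = 2.\<close>
  also have "Polygamma 2 (1 / 4) - Polygamma 2 (3 / 4 :: real) = - 4 * pi ^ 3"
    using Polygamma_2_reflection[of "1/4"]
    by (simp add: cos_45 sin_45 field_simps eval_nat_numeral)
  finally show ?thesis by simp
qed

text \<open>The even-numbered terms of zeta(3) sum to zeta(3) / 8; the odd-numbered ones form
  lambda(3).\<close>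

lemma lambda_3: "dirichlet_lambda 3 = 7 / 8 * zeta 3"
proof -
  have "(\<lambda>k. 1 / real (2 * k + 1) ^ 3 + 1 / 8 * (1 / real (Suc k) ^ 3)) sums zeta 3"
    using sums_pairs[OF zeta_sums[of 3]]
    by (rule back_subst[of "\<lambda>f. f sums zeta 3"])
       (auto simp: fun_eq_iff field_simps eval_nat_numeral)
  moreover have "(\<lambda>k. 1 / real (2 * k + 1) ^ 3 + 1 / 8 * (1 / real (Suc k) ^ 3)) sums
      (dirichlet_lambda 3 + 1 / 8 * zeta 3)"
    by (intro sums_add sums_mult zeta_sums lambda_sums) auto
  ultimately have "zeta 3 = dirichlet_lambda 3 + 1 / 8 * zeta 3"
    by (rule sums_unique2)
  then show ?thesis by simp
qed

section \<open>Paired series for ln 2 and the Leibniz series for pi\<close>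

lemma ln_2_sums_even_odd: "(\<lambda>k. 1 / real (2 * k + 2) - 1 / real (2 * k + 3)) sums (1 - ln 2)"
proof -
  have "(\<lambda>k. - ((- 1) ^ Suc k / real (Suc (Suc k)))) sums - (ln 2 - 1)"
    using sums_minus[OF sums_shift_one[OF alternating_harmonic_series_sums]] by simp
  from sums_pairs[OF this] show ?thesis
    by (simp add: algebra_simps)
qed

lemma ln_2_sums_odd_even: "(\<lambda>k. 1 / real (2 * k + 1) - 1 / real (2 * k + 2)) sums ln 2"
  using alternating_harmonic_series_sums' by (simp add: inverse_eq_divide)

lemma pi_4_sums: "(\<lambda>k. (- 1) ^ k / real (2 * k + 1)) sums (pi / 4)"
proof -
  have "summable (\<lambda>k. (- 1) ^ k * (1 / real (k * 2 + 1) * 1 ^ (k * 2 + 1)) :: real)"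
    by (rule summable_arctan_series) simp
  then have "summable (\<lambda>k. (- 1) ^ k / real (2 * k + 1))"
    by (simp add: mult.commute)
  then show ?thesis
    using pi_series by (simp add: sums_iff mult.commute)
qed

subsection \<open>The sequence b_n\<close>

text \<open>The common first term of the three defining series is 5 - 1 - 4 = 0, so summation may
  start at the odd number 3. This flips the alternating sign and makes the ratio 1 / (2k + 3)^2 at
  most 1/9, as the geometric summation over m requires.\<close>

lemma b_seq_sums:
  "(\<lambda>k. (5 - real (2 * k + 3) ^ 2 + 4 * (- 1) ^ k) / real (2 * k + 3) ^ 5 * (1 / real (2 * k + 3) ^ 2) ^ m)
     sums b_seq (m + 2)"
proof -
  have term_eq: "5 * (1 / r ^ (2 * m + 5)) - 1 / r ^ (2 * m + 3) - 4 * (s / r ^ (2 * m + 5))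
      = (5 - r ^ 2 - 4 * s) / r ^ 5 * (1 / r ^ 2) ^ m" if "0 < r" for r s :: real
    using that by (simp add: power_add power_mult power_divide divide_simps eval_nat_numeral)
  let ?f = "\<lambda>k. 5 * (1 / real (2 * k + 1) ^ (2 * m + 5)) - 1 / real (2 * k + 1) ^ (2 * m + 3)
      - 4 * ((- 1) ^ k / real (2 * k + 1) ^ (2 * m + 5))"
  have "?f sums (5 * dirichlet_lambda (2 * m + 5) - dirichlet_lambda (2 * m + 3)
      - 4 * dirichlet_beta (2 * m + 5))"
    by (intro sums_diff sums_mult lambda_sums beta_sums) auto
  also have "5 * dirichlet_lambda (2 * m + 5) - dirichlet_lambda (2 * m + 3)
      - 4 * dirichlet_beta (2 * m + 5) = b_seq (m + 2)"
    by (simp add: b_seq_def eval_nat_numeral)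
  finally have "(\<lambda>k. ?f (Suc k)) sums (b_seq (m + 2) - ?f 0)"
    by (rule sums_shift_one)
  moreover have "?f (Suc k) = (5 - real (2 * k + 3) ^ 2 + 4 * (- 1) ^ k) / real (2 * k + 3) ^ 5
      * (1 / real (2 * k + 3) ^ 2) ^ m" for k
    using term_eq[of "real (2 * Suc k + 1)" "(- 1) ^ Suc k"] by (simp add: algebra_simps)
  ultimately show ?thesis by simp
qed

lemma b_seq_term_numerator_nonpos:
  "5 - real (2 * k + 3) ^ 2 + 4 * (- 1) ^ k \<le> 0"
proof -
  have "3 ^ 2 \<le> real (2 * k + 3) ^ 2" by (intro power_mono) auto
  then show ?thesis by (cases "even k") auto
qed

text \<open>No term is positive. The strict term is the one at k = 1, since at k = 0 the numerator
  is 5 - 9 + 4 = 0.\<close>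

lemma b_seq_neg: "b_seq (m + 2) < 0"
proof (rule sums_less[OF b_seq_sums sums_zero, where i = 1])
  show "(5 - real (2 * k + 3) ^ 2 + 4 * (- 1) ^ k) / real (2 * k + 3) ^ 5
      * (1 / real (2 * k + 3) ^ 2) ^ m \<le> 0" for k
    by (intro mult_nonpos_nonneg divide_nonpos_nonneg b_seq_term_numerator_nonpos) auto
  show "(5 - real (2 * 1 + 3) ^ 2 + 4 * (- 1) ^ 1) / real (2 * 1 + 3) ^ 5
      * (1 / real (2 * 1 + 3) ^ 2) ^ m < 0"
    by (intro mult_neg_pos divide_neg_pos) auto
qed

lemma b_seq_total: "b_seq sums 1"
proof -
  define r where "r k = real (2 * k + 3)" for k
  define s :: "nat \<Rightarrow> real" where "s k = (- 1) ^ k" for k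
  have r: "3 \<le> r k" for k by (simp add: r_def)
  define g where "g k = (5 - r k ^ 2 + 4 * s k) / r k ^ 5" for k
  \<comment> \<open>The claimed value is 1 - b_0 - b_1, with zeta(3) and pi^3 rewritten through
    lambda(3) and beta(3).\<close>
  have "(\<lambda>m. b_seq (m + 2)) sums (1 - 4 * ln 2 + pi - 5 * dirichlet_lambda 3 + 4 * dirichlet_beta 3)"
  proof (rule sums_geometric_swap)
    show "(\<lambda>k. g k * (1 / r k ^ 2) ^ m) sums b_seq (m + 2)" for m
      using b_seq_sums[of m] by (simp add: g_def r_def s_def)
    have "summable (\<lambda>k. - g k)"
      using sums_summable[OF sums_minus[OF b_seq_sums[of 0]]] by (simp add: g_def r_def s_def)
    moreover have "\<bar>g k\<bar> = - g k" for k
      using b_seq_term_numerator_nonpos[of k]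
      by (intro abs_of_nonpos) (auto simp: g_def r_def s_def intro!: divide_nonpos_nonneg)
    ultimately show "summable (\<lambda>k. \<bar>g k\<bar>)" by simp
    show "0 \<le> 1 / r k ^ 2" for k by simp
    have "3 ^ 2 \<le> r k ^ 2" for k using r by (intro power_mono) auto
    then show "1 / r k ^ 2 \<le> 1 / 2" for k
      using r[of k] by (simp add: divide_simps) (smt (verit))
    \<comment> \<open>Partial fractions in r = 2k + 3. The series of 1 / r and 1 / (r - 1), 1 / (r +
      1) diverge separately, so these fractions are grouped into differences that converge to
      expressions in ln 2.\<close>
    have split: "g k / (1 - 1 / r k ^ 2) = 2 * ((1 / (r k - 1) - 1 / r k) - (1 / r k - 1 / (r k + 1)))
        - 5 * (1 / r k ^ 3) + 2 * (s k / (r k - 1) + s k / (r k + 1)) - 4 * (s k / r k)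
        - 4 * (s k / r k ^ 3)" for k
    proof -
      define x where "x = r k"
      have "3 \<le> x" using r by (simp add: x_def)
      then have nz: "x \<noteq> 0" "x - 1 \<noteq> 0" "x + 1 \<noteq> 0" "x\<^sup>2 \<noteq> 1"
        by (auto simp: power2_eq_1_iff)
      have *: "1 - 1 / x ^ 2 = (x - 1) * (x + 1) / x ^ 2"
        using nz by (simp add: field_simps power2_eq_square)
      have "(5 - x ^ 2 + 4 * s k) / x ^ 5 / (1 - 1 / x ^ 2)
        = (5 - x ^ 2 + 4 * s k) / (x ^ 3 * (x - 1) * (x + 1))"
        unfolding * using nz by (simp add: divide_simps eval_nat_numeral)
      also have "\<dots> = 2 * ((1 / (x - 1) - 1 / x) - (1 / x - 1 / (x + 1)))
        - 5 * (1 / x ^ 3) + 2 * (s k / (x - 1) + s k / (x + 1)) - 4 * (s k / x) - 4 * (s k / x ^ 3)"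
        using nz by (simp add: divide_simps) (simp add: algebra_simps eval_nat_numeral)
      finally show ?thesis by (simp add: g_def x_def)
    qed
    have 1: "(\<lambda>k. 1 / (r k - 1) - 1 / r k) sums (1 - ln 2)"
      using ln_2_sums_even_odd by (simp add: r_def)
    have 2: "(\<lambda>k. 1 / r k - 1 / (r k + 1)) sums (ln 2 - 1 / 2)"
      using sums_shift_one[OF ln_2_sums_odd_even] by (simp add: r_def algebra_simps)
    have 3: "(\<lambda>k. 1 / r k ^ 3) sums (dirichlet_lambda 3 - 1)"
      using sums_shift_one[OF lambda_sums[of 3]] by (simp add: r_def algebra_simps)
    have 4: "(\<lambda>k. s k / r k ^ 3) sums (1 - dirichlet_beta 3)"
      using sums_minus[OF sums_shift_one[OF beta_sums[of 3]]] by (simp add: r_def s_def algebra_simps)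
    have 5: "(\<lambda>k. s k / r k) sums (1 - pi / 4)"
      using sums_minus[OF sums_shift_one[OF pi_4_sums]] by (simp add: r_def s_def algebra_simps)
    have "(\<lambda>k. s k / real (2 * k + 2)) \<longlonglongrightarrow> 0"
    proof (rule Lim_null_comparison)
      show "(\<lambda>k. 1 / real (Suc k)) \<longlonglongrightarrow> 0"
        using LIMSEQ_inverse_real_of_nat by (simp add: inverse_eq_divide)
      show "\<forall>\<^sub>F k in sequentially. norm (s k / real (2 * k + 2)) \<le> 1 / real (Suc k)"
        by (auto simp: s_def abs_divide power_abs divide_simps intro!: always_eventually)
    qed
    \<comment> \<open>Since \<open>s (Suc k) = - s k\<close>, the sum telescopes to its first term
      1/2.\<close>
    then have 6: "(\<lambda>k. s k / (r k - 1) + s k / (r k + 1)) sums (1 / 2)"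
      using telescope_sums'[of "\<lambda>k. s k / real (2 * k + 2)" 0]
      by (simp add: r_def s_def algebra_simps)
    have "(\<lambda>k. g k / (1 - 1 / r k ^ 2)) sums (2 * ((1 - ln 2) - (ln 2 - 1 / 2))
        - 5 * (dirichlet_lambda 3 - 1) + 2 * (1 / 2) - 4 * (1 - pi / 4) - 4 * (1 - dirichlet_beta 3))"
      unfolding split by (intro sums_add sums_diff sums_mult 1 2 3 4 5 6)
    then show "(\<lambda>k. g k / (1 - 1 / r k ^ 2)) sums
        (1 - 4 * ln 2 + pi - 5 * dirichlet_lambda 3 + 4 * dirichlet_beta 3)"
      by (simp add: algebra_simps)
  qed
  then have "b_seq sums ((1 - 4 * ln 2 + pi - 5 * dirichlet_lambda 3 + 4 * dirichlet_beta 3)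
      + (\<Sum>i<2. b_seq i))"
    by (subst (asm) sums_iff_shift)
  also have "(\<Sum>i<2. b_seq i) = 4 * ln 2 - pi + 5 * dirichlet_lambda 3 - 4 * dirichlet_beta 3"
    by (simp add: b_seq_def numeral_2_eq_2 lambda_3 beta_3 field_simps)
  finally show ?thesis by simp
qed

text \<open>As the total is 1, c_n - b_{n+1} is the tail of the series from index n + 2 on, where
  every b is negative.\<close>

lemma c_seq_less_b_seq: "c_seq n < b_seq (n + 1)"
proof -
  have "(\<lambda>m. b_seq (m + (n + 2))) sums (1 - (\<Sum>i<n + 2. b_seq i))"
    by (rule sums_split_initial_segment[OF b_seq_total])
  moreover have "b_seq (m + (n + 2)) < 0" for m
    using b_seq_neg[of "m + n"] by (simp add: algebra_simps)
  ultimately have "1 - (\<Sum>i<n + 2. b_seq i) < 0"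
    using sums_less[OF _ sums_zero, where i = 0] by (meson less_imp_le)
  moreover have "(\<Sum>i<n + 2. b_seq i) = (\<Sum>i=0..n. b_seq i) + b_seq (n + 1)"
    by (simp add: lessThan_Suc_atMost atMost_atLeast0)
  ultimately show ?thesis by (simp add: c_seq_def)
qed

subsection \<open>The sequence a_n\<close>

lemma a_seq_odd_full_sums:
  assumes "1 \<le> n"
  shows "(\<lambda>k. 2 * (1 / real (Suc k) ^ (2 * n + 1) - (- 1) ^ k / real (Suc k) ^ (2 * n + 2)))
    sums a_seq (2 * n + 1)"
proof -
  have "a_seq (2 * n + 1) = 2 * (zeta (2 * n + 1) - dirichlet_eta (2 * n + 2))"
    using assms by (simp add: a_seq_def)
  moreover have "(\<lambda>k. 2 * (1 / real (Suc k) ^ (2 * n + 1) - (- 1) ^ k / real (Suc k) ^ (2 * n + 2)))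
      sums (2 * (zeta (2 * n + 1) - dirichlet_eta (2 * n + 2)))"
    using assms by (intro sums_mult sums_diff zeta_sums eta_sums) auto
  ultimately show ?thesis by simp
qed

lemma a_seq_even_full_sums:
  assumes "1 \<le> n"
  shows "(\<lambda>k. 2 * (1 / real (Suc k) ^ (2 * n + 3) - 1 / real (Suc k) ^ (2 * n + 1)))
    sums a_seq (2 * n + 2)"
proof -
  have "a_seq (2 * n + 2) = 2 * (zeta (2 * n + 3) - zeta (2 * n + 1))"
    using assms by (simp add: a_seq_def numeral_3_eq_3)
  moreover have "(\<lambda>k. 2 * (1 / real (Suc k) ^ (2 * n + 3) - 1 / real (Suc k) ^ (2 * n + 1)))
      sums (2 * (zeta (2 * n + 3) - zeta (2 * n + 1)))"
    using assms by (intro sums_mult sums_diff zeta_sums) auto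
  ultimately show ?thesis by simp
qed

text \<open>The term of the full series at k = 0 is 2 (1 - 1) = 0. Dropping it changes the sign of
  the alternating part and leaves bases that are at least 2, on which the comparisons below
  rely.\<close>

lemma a_seq_odd_sums:
  assumes "1 \<le> n"
  shows "(\<lambda>k. 2 * (1 / real (k + 2) ^ (2 * n + 1) + (- 1) ^ k / real (k + 2) ^ (2 * n + 2)))
    sums a_seq (2 * n + 1)"
  using sums_shift_one[OF a_seq_odd_full_sums[OF assms]] by (simp add: algebra_simps)

lemma a_seq_even_sums:
  assumes "1 \<le> n"
  shows "(\<lambda>k. 2 * (1 / real (k + 2) ^ (2 * n + 3) - 1 / real (k + 2) ^ (2 * n + 1)))
    sums a_seq (2 * n + 2)"
  using sums_shift_one[OF a_seq_even_full_sums[OF assms]] by (simp add: algebra_simps)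

lemma a_seq_even_neg:
  assumes "1 \<le> n"
  shows "a_seq (2 * n + 2) < 0"
proof (rule sums_less[OF a_seq_even_sums[OF assms] sums_zero, where i = 0])
  have less: "2 * (1 / real (k + 2) ^ (2 * n + 3) - 1 / real (k + 2) ^ (2 * n + 1)) < 0" for k
  proof (intro mult_pos_neg)
    show "1 / real (k + 2) ^ (2 * n + 3) - 1 / real (k + 2) ^ (2 * n + 1) < 0"
      unfolding less_iff_diff_less_0[symmetric]
      by (intro divide_strict_left_mono power_strict_increasing) auto
  qed simp
  show "2 * (1 / real (k + 2) ^ (2 * n + 3) - 1 / real (k + 2) ^ (2 * n + 1)) \<le> 0" for k
    using less[of k] by (rule less_imp_le)
  show "2 * (1 / real (0 + 2) ^ (2 * n + 3) - 1 / real (0 + 2) ^ (2 * n + 1)) < 0"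
    by (rule less)
qed

text \<open>With x = k + 2 and s = (-1)^k, the difference of the terms has the sign of x (x^2 - 3) -
  2 s. This is nonnegative for x >= 2 and vanishes at k = 0, hence the strict term at k = 1.\<close>

lemma a_seq_halving:
  assumes "1 \<le> n"
  shows "2 * a_seq (2 * n + 3) < - a_seq (2 * n + 2)"
proof (rule sums_less[where i = 1])
  have "(\<lambda>k. 2 * (1 / real (k + 2) ^ (2 * n + 3) + (- 1) ^ k / real (k + 2) ^ (2 * n + 4)))
    sums a_seq (2 * n + 3)"
    using a_seq_odd_sums[of "n + 1"] by (simp add: eval_nat_numeral)
  then show "(\<lambda>k. 2 * (2 * (1 / real (k + 2) ^ (2 * n + 3) + (- 1) ^ k / real (k + 2) ^ (2 * n + 4))))
    sums (2 * a_seq (2 * n + 3))"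
    by (rule sums_mult)
  show "(\<lambda>k. - (2 * (1 / real (k + 2) ^ (2 * n + 3) - 1 / real (k + 2) ^ (2 * n + 1))))
    sums - a_seq (2 * n + 2)"
    by (intro sums_minus a_seq_even_sums assms)
  have term_eq: "- (2 * (1 / x ^ (2 * n + 3) - 1 / x ^ (2 * n + 1))) -
      2 * (2 * (1 / x ^ (2 * n + 3) + s / x ^ (2 * n + 4))) = 2 * (x * (x ^ 2 - 3) - 2 * s) / x ^ (2 * n + 4)"
    if "0 < x" for x s :: real
    using that by (simp add: divide_simps power_add eval_nat_numeral) (simp add: algebra_simps)
  have "0 \<le> x * (x ^ 2 - 3) - 2 * (- 1) ^ k" if "2 \<le> x" for x :: real and k :: nat
  proof -
    have "2 ^ 2 \<le> x ^ 2" using that by (intro power_mono) auto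
    then have "2 * 1 \<le> x * (x ^ 2 - 3)" using that by (intro mult_mono) auto
    then show ?thesis by (cases "even k") auto
  qed
  then have "0 \<le> 2 * (real (k + 2) * (real (k + 2) ^ 2 - 3) - 2 * (- 1) ^ k) / real (k + 2) ^ (2 * n + 4)" for k
    by simp
  then show "2 * (2 * (1 / real (k + 2) ^ (2 * n + 3) + (- 1) ^ k / real (k + 2) ^ (2 * n + 4)))
    \<le> - (2 * (1 / real (k + 2) ^ (2 * n + 3) - 1 / real (k + 2) ^ (2 * n + 1)))" for k
    using term_eq[of "real (k + 2)" "(- 1) ^ k"]
    by (metis diff_ge_0_iff_ge of_nat_0_less_iff add_gr_0 zero_less_numeral)
  have "0 < 2 * (real (1 + 2) * (real (1 + 2) ^ 2 - 3) - 2 * (- 1) ^ 1) / real (1 + 2) ^ (2 * n + 4)"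
    by simp
  then show "2 * (2 * (1 / real (1 + 2) ^ (2 * n + 3) + (- 1) ^ 1 / real (1 + 2) ^ (2 * n + 4)))
    < - (2 * (1 / real (1 + 2) ^ (2 * n + 3) - 1 / real (1 + 2) ^ (2 * n + 1)))"
    using term_eq[of "real (1 + 2)" "(- 1) ^ 1"]
    by (metis diff_gt_0_iff_gt of_nat_0_less_iff add_gr_0 zero_less_numeral)
qed

text \<open>In a_{2n+1} + a_{2n+2} the powers of exponent 2n + 1 cancel. What remains is an
  alternating series with decreasing terms plus a positive one, so consecutive pairs are
  positive.\<close>

lemma a_seq_even_less_odd:
  assumes "1 \<le> n"
  shows "- a_seq (2 * n + 2) < a_seq (2 * n + 1)"
proof -
  let ?f = "\<lambda>k. 2 * ((- 1) ^ k / real (k + 2) ^ (2 * n + 2) + 1 / real (k + 2) ^ (2 * n + 3))"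
  have "?f sums (a_seq (2 * n + 1) + a_seq (2 * n + 2))"
    using sums_add[OF a_seq_odd_sums[OF assms] a_seq_even_sums[OF assms]]
    by (simp add: algebra_simps)
  from sums_pairs[OF this] have "(\<lambda>k. ?f (2 * k) + ?f (2 * k + 1)) sums (a_seq (2 * n + 1) + a_seq (2 * n + 2))" .
  moreover have "0 < ?f (2 * k) + ?f (2 * k + 1)" for k
  proof -
    have "1 / real (2 * k + 1 + 2) ^ (2 * n + 2) < 1 / real (2 * k + 2) ^ (2 * n + 2)"
      by (intro divide_strict_left_mono power_strict_mono) auto
    moreover have "0 < 1 / real (2 * k + 2) ^ (2 * n + 3)" "0 < 1 / real (2 * k + 1 + 2) ^ (2 * n + 3)"
      by simp_all
    moreover have "0 < 2 * (1 / u + c) + 2 * (- 1 / v + d)"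
      if "1 / v < 1 / u" "0 < c" "0 < d" for u v c d :: real
      using that by simp
    ultimately have "0 < 2 * (1 / real (2 * k + 2) ^ (2 * n + 2) + 1 / real (2 * k + 2) ^ (2 * n + 3))
        + 2 * (- 1 / real (2 * k + 1 + 2) ^ (2 * n + 2) + 1 / real (2 * k + 1 + 2) ^ (2 * n + 3))"
      by blast
    moreover have "(- 1) ^ (2 * k) = (1::real)" "(- 1) ^ (2 * k + 1) = (- 1::real)"
      by simp_all
    ultimately show ?thesis
      by (simp only:)
  qed
  ultimately have "0 < a_seq (2 * n + 1) + a_seq (2 * n + 2)"
    using sums_less[OF sums_zero, where i = 0] by (meson less_imp_le)
  then show ?thesis by simp
qed

lemma eta_4_pos: "0 < dirichlet_eta 4"
proof (rule sums_less[OF sums_zero sums_pairs[OF eta_sums], where i = 0])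
  have *: "1 / real (Suc (2 * k + 1)) ^ 4 < 1 / real (Suc (2 * k)) ^ 4" for k
    by (intro divide_strict_left_mono power_strict_mono) auto
  show "0 \<le> (- 1) ^ (2 * k) / real (Suc (2 * k)) ^ 4 + (- 1) ^ (2 * k + 1) / real (Suc (2 * k + 1)) ^ 4" for k
    using *[of k] by simp
qed auto

text \<open>The first pair contributes 1 - 1/4 = 3/4, and every later pair is positive.\<close>

lemma eta_2_gt: "3 / 4 < dirichlet_eta 2"
proof (rule sums_less[OF sums_single[of 0 "\<lambda>_. 3 / 4"] sums_pairs[OF eta_sums], where i = 1])
  have *: "1 / real (Suc (2 * k + 1)) ^ 2 < 1 / real (Suc (2 * k)) ^ 2" for k
    by (intro divide_strict_left_mono power_strict_mono) auto
  show "(if k = 0 then 3 / 4 else 0) \<le>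
      (- 1) ^ (2 * k) / real (Suc (2 * k)) ^ 2 + (- 1) ^ (2 * k + 1) / real (Suc (2 * k + 1)) ^ 2" for k
    using *[of k] by (auto simp: power2_eq_square)
qed auto

subsection \<open>Bounds for the zeta function\<close>

lemma inverse_cube_tail_sums:
  assumes "2 \<le> K"
  shows "(\<lambda>k. 1 / 2 * (1 / (real (k + K - 1) * real (k + K)) - 1 / (real (k + K) * real (k + K + 1))))
    sums (1 / 2 * (1 / ((real K - 1) * real K)))"
proof -
  have "(\<lambda>k. 1 / (real (k + K - 1) * real (k + K))) \<longlonglongrightarrow> 0"
  proof (rule Lim_null_comparison)
    show "(\<lambda>k. 1 / real (Suc k)) \<longlonglongrightarrow> 0"
      using LIMSEQ_inverse_real_of_nat by (simp add: inverse_eq_divide)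
    have "1 / (real (k + K - 1) * real (k + K)) \<le> 1 / (real (Suc k) * 1)" for k
      using assms by (intro divide_left_mono mult_mono) (auto simp del: of_nat_Suc)
    then show "\<forall>\<^sub>F k in sequentially. norm (1 / (real (k + K - 1) * real (k + K))) \<le> 1 / real (Suc k)"
      by (intro always_eventually) auto
  qed
  from sums_mult[OF telescope_sums'[OF this], of "1 / 2"] show ?thesis
    using assms by (simp add: of_nat_diff)
qed

text \<open>The right-hand side equals 1 / ((x - 1) x (x + 1)), the telescoping majorant of 1 / x^3
  that was summed in \<open>inverse_cube_tail_sums\<close>.\<close>

lemma inverse_cube_le:
  fixes x :: real
  assumes "1 < x"
  shows "1 / x ^ 3 \<le> 1 / 2 * (1 / ((x - 1) * x) - 1 / (x * (x + 1)))"
proof -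
  have "1 / 2 * (1 / ((x - 1) * x) - 1 / (x * (x + 1))) = 1 / (x * (x ^ 2 - 1))"
    using assms power2_eq_1_iff[of x] by (simp add: divide_simps) (simp add: algebra_simps power2_eq_square)
  moreover have "1 / x ^ 3 \<le> 1 / (x * (x ^ 2 - 1))"
    using assms one_less_power[of x 2] by (intro divide_left_mono) (auto simp: algebra_simps eval_nat_numeral)
  ultimately show ?thesis by simp
qed

text \<open>Numerical upper bounds: the first K terms are kept exactly, and the tail, whose bases
  start at K + 1, is bounded by the telescoping majorant.\<close>

lemma series_cube_tail_le:
  fixes f :: "nat \<Rightarrow> real"
  assumes "f sums s" "1 \<le> K" "0 \<le> c" "\<And>k. K \<le> k \<Longrightarrow> f k \<le> c / real (Suc k) ^ 3"
  shows "s \<le> (\<Sum>k<K. f k) + c / (2 * real K * (real K + 1))"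
proof -
  have "s - sum f {..<K} \<le> c * (1 / 2 * (1 / ((real (Suc K) - 1) * real (Suc K))))"
  proof (rule sums_le[OF _ sums_split_initial_segment[OF assms(1)] sums_mult[OF inverse_cube_tail_sums]])
    fix k
    have "f (k + K) \<le> c / real (k + Suc K) ^ 3"
      using assms(4)[of "k + K"] by simp
    also have "\<dots> \<le> c * (1 / 2 * (1 / ((real (k + Suc K) - 1) * real (k + Suc K))
        - 1 / (real (k + Suc K) * (real (k + Suc K) + 1))))"
      using mult_left_mono[OF inverse_cube_le[of "real (k + Suc K)"] assms(3)] assms(2) by simp
    finally show "f (k + K) \<le> c * (1 / 2 * (1 / (real (k + Suc K - 1) * real (k + Suc K))
        - 1 / (real (k + Suc K) * real (k + Suc K + 1))))"
      by (simp add: add_ac)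
  qed (use assms in auto)
  then show ?thesis by (simp add: algebra_simps)
qed

lemma zeta_ge_partial_sum:
  assumes "2 \<le> n"
  shows "(\<Sum>k<K. 1 / real (Suc k) ^ n) \<le> zeta n"
  using sum_le_suminf[OF summable_inverse_Suc_power[OF assms], of "{..<K}"] by (simp add: zeta_def)

text \<open>Four exact terms plus a tail bounded by 1 / (x - 1/2) - 1 / (x + 1/2) = 1 / (x^2 - 1/4).
  The tail starts at x = 5 and hence adds 1 / (9/2) = 2/9, for a total below 1.646.\<close>

lemma zeta_2_le: "zeta 2 \<le> 1.65"
proof -
  have t: "(\<lambda>k. 1 / (real k + 9 / 2)) \<longlonglongrightarrow> 0"
    by real_asymp
  have "zeta 2 - (\<Sum>k<4. 1 / real (Suc k) ^ 2) \<le> 1 / (real 0 + 9 / 2) - 0"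
  proof (rule sums_le[OF _ sums_split_initial_segment[OF zeta_sums] telescope_sums'[OF t]])
    have *: "1 / x ^ 2 \<le> 1 / (x - 1 / 2) - 1 / (x + 1 / 2)" if "1 \<le> x" for x :: real
    proof -
      have "1 / (x - 1 / 2) - 1 / (x + 1 / 2) = 1 / (x ^ 2 - 1 / 4)"
      proof -
        have "x ^ 2 - 1 / 4 = (x - 1 / 2) * (x + 1 / 2)"
          by (simp add: algebra_simps power2_eq_square)
        moreover have "x - 1 / 2 \<noteq> 0" "x + 1 / 2 \<noteq> 0"
          using that by auto
        ultimately show ?thesis
          by (simp add: diff_frac_eq)
      qed
      moreover have "1 / x ^ 2 \<le> 1 / (x ^ 2 - 1 / 4)"
      proof -
        have "1 \<le> x ^ 2" using that by (rule one_le_power)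
        then have "0 < x ^ 2 - 1 / 4" by linarith
        then show ?thesis using that by (intro divide_left_mono mult_pos_pos) auto
      qed
      ultimately show ?thesis by simp
    qed
    show "1 / real (Suc (k + 4)) ^ 2 \<le> 1 / (real k + 9 / 2) - 1 / (real (Suc k) + 9 / 2)" for k
      using *[of "real k + 5"] by (simp add: algebra_simps)
  qed simp
  then show ?thesis by (simp add: eval_nat_numeral)
qed

lemma zeta_3_le: "zeta 3 \<le> 1.21"
  using series_cube_tail_le[OF zeta_sums[of 3], of 4 1] by (simp add: eval_nat_numeral)

lemma zeta_gt_1: "2 \<le> n \<Longrightarrow> 1 < zeta n"
  by (rule sums_less[OF sums_single[of 0 "\<lambda>_. 1"] zeta_sums, where i = 1]) auto

text \<open>From base 2 on, one more factor at least halves a term; the extra 1/2 at k = 0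
  compensates for the term 1. Base 2 still gives equality, so strictness comes from base 3, that is
  k = 2.\<close>

lemma zeta_Suc_less:
  assumes "2 \<le> n"
  shows "zeta (n + 1) < (zeta n + 1) / 2"
proof -
  have S: "(\<lambda>k. 1 / 2 * (1 / real (Suc k) ^ n) + (if k = 0 then 1 / 2 else 0)) sums (1 / 2 * zeta n + 1 / 2)"
    by (intro sums_add sums_mult zeta_sums assms sums_single[of 0 "\<lambda>_. 1 / 2"])
  have "zeta (n + 1) < 1 / 2 * zeta n + 1 / 2"
  proof (rule sums_less[OF zeta_sums S, where i = 2])
    show "1 / real (Suc k) ^ (n + 1) \<le> 1 / 2 * (1 / real (Suc k) ^ n) + (if k = 0 then 1 / 2 else 0)" for k
    proof (cases k)
      case (Suc l)
      have "1 / real (Suc k) * (1 / real (Suc k) ^ n) \<le> 1 / 2 * (1 / real (Suc k) ^ n)"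
        by (intro mult_right_mono divide_left_mono) (auto simp: Suc)
      then show ?thesis by (simp add: Suc)
    qed simp
  qed (use assms in \<open>auto simp: field_simps\<close>)
  then show ?thesis by simp
qed

text \<open>For each base j >= 2 the factor (2 / j)^n is nonincreasing in n, and the term of base 1
  vanishes; hence n = 4 is the worst case and is estimated numerically. The bound 43/108 is 1 -
  65/108.\<close>

lemma zeta_drop_less:
  assumes "4 \<le> n"
  shows "2 ^ (n - 1) * (zeta n - zeta (n + 1)) < 43 / 108"
proof -
  let ?f = "\<lambda>m k. 1 / real (Suc k) ^ m - 1 / real (Suc k) ^ (m + 1)"
  have f: "?f m sums (zeta m - zeta (m + 1))" if "2 \<le> m" for m
    using that by (intro sums_diff zeta_sums) auto
  have "2 ^ (n - 1) * (zeta n - zeta (n + 1)) \<le> 8 * (zeta 4 - zeta (4 + 1))"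
  proof (rule sums_le[OF _ sums_mult[OF f] sums_mult[OF f]])
    fix k
    have f_eq: "?f m k = (1 - 1 / real (Suc k)) / real (Suc k) ^ m" for m
      by (simp add: diff_divide_distrib)
    obtain j where j: "n = j + 4" using assms le_Suc_ex by (metis add.commute)
    show "2 ^ (n - 1) * ?f n k \<le> 8 * ?f 4 k"
    proof (cases k)
      case (Suc l)
      have "2 ^ j \<le> real (Suc k) ^ j" by (intro power_mono) (auto simp: Suc)
      then have "2 ^ j / real (Suc k) ^ j * (8 * ((1 - 1 / real (Suc k)) / real (Suc k) ^ 4))
          \<le> 1 * (8 * ((1 - 1 / real (Suc k)) / real (Suc k) ^ 4))"
        by (intro mult_right_mono) (auto simp: divide_simps)
      also have "2 ^ j / real (Suc k) ^ j * (8 * ((1 - 1 / real (Suc k)) / real (Suc k) ^ 4))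
          = 2 ^ (n - 1) * ?f n k"
        unfolding f_eq j by (simp add: power_add)
      finally show ?thesis unfolding f_eq by simp
    qed simp
  qed (use assms in auto)
  \<comment> \<open>The constant 1/5 comes from 1 / x^4 <= 1 / (5 x^3) for the remaining bases x >=
    5.\<close>
  also have "zeta 4 - zeta (4 + 1) \<le> (\<Sum>k<4. ?f 4 k) + (1 / 5) / (2 * real 4 * (real 4 + 1))"
  proof (rule series_cube_tail_le[OF f])
    fix k :: nat assume "4 \<le> k"
    then have "5 * real (Suc k) ^ 3 \<le> real (Suc k) * real (Suc k) ^ 3"
      by (intro mult_right_mono) auto
    then have "1 / real (Suc k) ^ 4 \<le> 1 / (5 * real (Suc k) ^ 3)"
      by (intro divide_left_mono) (auto simp: eval_nat_numeral)
    moreover have "?f 4 k \<le> 1 / real (Suc k) ^ 4" by simp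
    ultimately have "?f 4 k \<le> 1 / (5 * real (Suc k) ^ 3)" by (rule order_trans[rotated])
    then show "?f 4 k \<le> (1 / 5) / real (Suc k) ^ 3" by simp
  qed auto
  then have "8 * (zeta 4 - zeta (4 + 1)) < 43 / 108"
    by (simp add: eval_nat_numeral)
  finally show ?thesis .
qed

lemma zeta_Suc_greater:
  assumes "2 \<le> n"
  shows "(1 - (1 - 65 / 108) / (2 ^ (n - 1) - 65 / 108)) * zeta n < zeta (n + 1)"
proof -
  consider "n = 2" | "n = 3" | "4 \<le> n" using assms by linarith
  then show ?thesis
  proof cases
    case 1
    then show ?thesis
      \<comment> \<open>The factor is 108/151 here: 1.65 times it is about 1.1801, while five terms
        of zeta(3) give about 1.1857.\<close>
      using zeta_2_le zeta_ge_partial_sum[of 3 5] by (simp add: eval_nat_numeral)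
  next
    case 2
    then show ?thesis
      \<comment> \<open>The factor is 324/367 here: 1.21 times it is about 1.0682, while three terms
        of zeta(4) give about 1.0748.\<close>
      using zeta_3_le zeta_ge_partial_sum[of 4 3] by (simp add: eval_nat_numeral)
  next
    case 3
    have "2 ^ (n - 1) * (zeta n - zeta (n + 1)) < 43 / 108 * 1"
      using zeta_drop_less[OF 3] by simp
    also have "\<dots> \<le> 43 / 108 * zeta n"
      using zeta_gt_1[OF assms] by simp
    finally have *: "2 ^ (n - 1) * (zeta n - zeta (n + 1)) < 43 / 108 * zeta n" .
    \<comment> \<open>Cleared of its denominator, the claim reads (2^(n-1) - mu) (zeta(n) -
      zeta(n+1)) < (1 - mu) zeta(n) with mu = 65/108. Omitting -mu on the left only enlarges that
      side because zeta decreases.\<close>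
    have "zeta (n + 1) < zeta n"
      using zeta_Suc_less[OF assms] zeta_gt_1[OF assms] by simp
    moreover have "(2::real) ^ 1 \<le> 2 ^ (n - 1)"
      using assms by (intro power_increasing) auto
    ultimately show ?thesis
      using * by (simp add: field_simps)
  qed
qed

subsection \<open>Monotonicity of |a_n|\<close>

lemma a_seq_odd_pos:
  assumes "1 \<le> n"
  shows "0 < a_seq (2 * n + 1)"
  using a_seq_even_neg[OF assms] a_seq_even_less_odd[OF assms] by linarith

lemma a_seq_3_less_2: "a_seq 3 < a_seq 2"
  using eta_4_pos by (simp add: a_seq_def)

text \<open>The number 2.5 separates the two sides: 2 zeta(3) <= 2.42, and 2 eta(2) + 1 > 3/2 +
  1.\<close>

lemma a_seq_2_less_1: "a_seq 2 < - a_seq 1"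
  using eta_2_gt zeta_3_le by (simp add: a_seq_def)

lemma odd_even_from_3_cases:
  fixes n :: nat
  assumes "3 \<le> n"
  obtains m where "1 \<le> m" "n = 2 * m + 1" | m where "1 \<le> m" "n = 2 * m + 2"
proof (cases "even n")
  case True
  then obtain l where "n = 2 * l" by (elim evenE)
  with assms show ?thesis by (intro that(2)[of "l - 1"]) auto
next
  case False
  then obtain l where "n = 2 * l + 1" by (elim oddE)
  with assms show ?thesis by (intro that(1)[of l]) auto
qed

lemma abs_a_seq_odd: "1 \<le> n \<Longrightarrow> \<bar>a_seq (2 * n + 1)\<bar> = a_seq (2 * n + 1)"
  using a_seq_odd_pos[of n] by simp

lemma abs_a_seq_odd': "1 \<le> n \<Longrightarrow> \<bar>a_seq (2 * n + 3)\<bar> = a_seq (2 * n + 3)"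
  using abs_a_seq_odd[of "n + 1"] by (simp add: numeral_3_eq_3)

lemma abs_a_seq_even: "1 \<le> n \<Longrightarrow> \<bar>a_seq (2 * n + 2)\<bar> = - a_seq (2 * n + 2)"
  using a_seq_even_neg[of n] by simp

lemma abs_a_seq_Suc_less:
  assumes "2 \<le> n"
  shows "\<bar>a_seq (n + 1)\<bar> < \<bar>a_seq n\<bar>"
proof (cases "n = 2")
  case True
  then show ?thesis
    using a_seq_3_less_2 a_seq_odd_pos[of 1] by simp
next
  case False
  then have "3 \<le> n" using assms by simp
  then show ?thesis
  proof (cases rule: odd_even_from_3_cases)
    case (1 m)
    then show ?thesis
      using a_seq_even_less_odd[of m] abs_a_seq_odd[of m] abs_a_seq_even[of m] by simp
  next
    case (2 m)
    have "\<bar>a_seq (2 * m + 3)\<bar> < \<bar>a_seq (2 * m + 2)\<bar>"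
      using 2(1) a_seq_halving[of m] abs_a_seq_odd'[of m] abs_a_seq_even[of m] by linarith
    then show ?thesis using 2(2) by (simp add: numeral_3_eq_3)
  qed
qed

lemma strict_antimono_on_atLeast_Suc:
  fixes f :: "nat \<Rightarrow> real"
  assumes "\<And>n. K \<le> n \<Longrightarrow> f (Suc n) < f n"
  shows "strict_antimono_on {K..} f"
proof (rule monotone_onI)
  fix m n :: nat
  assume "m \<in> {K..}" "m < n"
  have "f (Suc (m + k)) < f m" for k
  proof (induction k)
    case (Suc k)
    have "f (Suc (m + Suc k)) < f (Suc (m + k))"
      using \<open>m \<in> {K..}\<close> assms[of "Suc (m + k)"] by simp
    then show ?case using Suc by simp
  qed (use \<open>m \<in> {K..}\<close> assms in simp)
  moreover obtain k where "n = Suc (m + k)"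
    using \<open>m < n\<close> less_imp_Suc_add by blast
  ultimately show "f n < f m" by simp
qed

lemma abs_a_seq_antimono: "strict_antimono_on {2..} (\<lambda>n. \<bar>a_seq n\<bar>)"
  using abs_a_seq_Suc_less by (intro strict_antimono_on_atLeast_Suc) simp

lemma abs_a_seq_less:
  assumes "2 \<le> m" "m < n"
  shows "\<bar>a_seq n\<bar> < \<bar>a_seq m\<bar>"
  using monotone_onD[OF abs_a_seq_antimono, of m n] assms by simp

text \<open>Of two successive steps, the one from an even to an odd index more than halves the
  absolute value and the other decreases it. This gap is what makes the two subsequences of A_n
  monotone.\<close>

lemma abs_a_seq_two_step_gap:
  assumes "3 \<le> n"
  shows "\<bar>a_seq (n + 2)\<bar> < \<bar>a_seq n\<bar> - \<bar>a_seq (n + 1)\<bar> / 2"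
  using assms
proof (cases rule: odd_even_from_3_cases)
  case (1 m)
  have "2 * \<bar>a_seq (n + 2)\<bar> < \<bar>a_seq (n + 1)\<bar>"
    using 1 a_seq_halving[of m] abs_a_seq_odd'[of m] abs_a_seq_even[of m]
    by (simp add: numeral_3_eq_3)
  moreover have "\<bar>a_seq (n + 1)\<bar> < \<bar>a_seq n\<bar>"
    using assms by (intro abs_a_seq_Suc_less) simp
  ultimately show ?thesis by linarith
next
  case (2 m)
  have "2 * \<bar>a_seq (n + 1)\<bar> < \<bar>a_seq n\<bar>"
    using 2 a_seq_halving[of m] abs_a_seq_odd'[of m] abs_a_seq_even[of m]
    by (simp add: numeral_3_eq_3)
  moreover have "\<bar>a_seq (n + 2)\<bar> < \<bar>a_seq (n + 1)\<bar>"
    using assms abs_a_seq_Suc_less[of "n + 1"] by simp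
  ultimately show ?thesis by linarith
qed

lemma a_seq_pair_sign:
  assumes "1 \<le> n"
  shows "0 < a_seq (2 * n + 1) + a_seq (2 * n + 2) / 2"
    and "a_seq (2 * n + 2) + a_seq (2 * n + 3) / 2 < 0"
  using a_seq_even_less_odd[OF assms] a_seq_odd_pos[OF assms] a_seq_halving[OF assms]
    a_seq_even_neg[OF assms] by linarith+

text \<open>From index 3 on, |a_n| decreases and two steps at least halve it, so its limit L
  satisfies 0 <= L <= L / 2.\<close>

lemma a_seq_tendsto_0: "a_seq \<longlonglongrightarrow> 0"
proof -
  let ?d = "\<lambda>n. \<bar>a_seq (n + 3)\<bar>"
  have half: "?d (n + 2) \<le> ?d n / 2" for n
  proof -
    have "3 \<le> n + 3" by simp
    then show ?thesis
    proof (cases rule: odd_even_from_3_cases)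
      case (1 m)
      have "2 * \<bar>a_seq (n + 3 + 2)\<bar> < \<bar>a_seq (n + 3 + 1)\<bar>"
        unfolding 1(2) using 1(1) a_seq_halving[of m] abs_a_seq_odd'[of m] abs_a_seq_even[of m]
        by (simp add: numeral_3_eq_3)
      then show ?thesis
        using abs_a_seq_Suc_less[of "n + 3"] by (simp add: algebra_simps)
    next
      case (2 m)
      have "2 * \<bar>a_seq (n + 3 + 1)\<bar> < \<bar>a_seq (n + 3)\<bar>"
        unfolding 2(2) using 2(1) a_seq_halving[of m] abs_a_seq_odd'[of m] abs_a_seq_even[of m]
        by (simp add: numeral_3_eq_3)
      then show ?thesis
        using abs_a_seq_Suc_less[of "n + 4"] by (simp add: algebra_simps)
    qed
  qed
  have "decseq ?d"
    using abs_a_seq_less by (intro decseq_SucI less_imp_le) auto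
  then obtain L where L: "?d \<longlonglongrightarrow> L"
    using decseq_convergent[of ?d 0] by auto
  have "L \<le> L / 2"
  proof (rule LIMSEQ_le)
    show "(\<lambda>n. ?d (n + 2)) \<longlonglongrightarrow> L" using L by (rule LIMSEQ_ignore_initial_segment)
    show "(\<lambda>n. ?d n / 2) \<longlonglongrightarrow> L / 2" using L by (intro tendsto_divide) auto
  qed (use half in auto)
  moreover have "0 \<le> L" using L by (rule LIMSEQ_le_const) auto
  ultimately have "L = 0" by simp
  then have "(\<lambda>n. a_seq (n + 3)) \<longlonglongrightarrow> 0"
    using L tendsto_rabs_zero_iff by blast
  then show ?thesis by (rule LIMSEQ_offset)
qed

subsection \<open>The generating function of a_n at 1/2 and the remainders A_n\<close>

text \<open>Joining an odd index with the next even one makes the contribution of each k geometric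
  in m, as \<open>sums_geometric_swap\<close> needs. The vanishing terms at k = 0 are kept, so that
  the complete series of zeta(3) and eta(2) appear after partial fractions.\<close>

lemma a_seq_pair_sums:
  "(\<lambda>k. (1 / real (Suc k) ^ 5 + 1 / real (Suc k) ^ 3 - 2 * (- 1) ^ k / real (Suc k) ^ 4) / 8
      * (1 / (4 * real (Suc k) ^ 2)) ^ m)
    sums (a_seq (2 * m + 3) / 2 ^ (2 * m + 3) + a_seq (2 * m + 4) / 2 ^ (2 * m + 4))"
proof -
  have term_eq: "2 * (1 / x ^ (2 * (m + 1) + 1) - s / x ^ (2 * (m + 1) + 2)) / 2 ^ (2 * m + 3)
      + 2 * (1 / x ^ (2 * (m + 1) + 3) - 1 / x ^ (2 * (m + 1) + 1)) / 2 ^ (2 * m + 4)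
      = (1 / x ^ 5 + 1 / x ^ 3 - 2 * s / x ^ 4) / 8 * (1 / (4 * x ^ 2)) ^ m"
    if "0 < x" for x s :: real
  proof -
    have "(4::real) ^ m = 2 ^ (2 * m)" by (simp add: power_mult)
    then show ?thesis
      using that by (simp add: power_add power_mult power_divide power_mult_distrib divide_simps eval_nat_numeral)
        (simp add: algebra_simps)
  qed
  have "(\<lambda>k. 2 * (1 / real (Suc k) ^ (2 * (m + 1) + 1) - (- 1) ^ k / real (Suc k) ^ (2 * (m + 1) + 2)) / 2 ^ (2 * m + 3)
      + 2 * (1 / real (Suc k) ^ (2 * (m + 1) + 3) - 1 / real (Suc k) ^ (2 * (m + 1) + 1)) / 2 ^ (2 * m + 4))
    sums (a_seq (2 * (m + 1) + 1) / 2 ^ (2 * m + 3) + a_seq (2 * (m + 1) + 2) / 2 ^ (2 * m + 4))"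
    by (intro sums_add sums_divide a_seq_odd_full_sums a_seq_even_full_sums) auto
  then have "(\<lambda>k. (1 / real (Suc k) ^ 5 + 1 / real (Suc k) ^ 3 - 2 * (- 1) ^ k / real (Suc k) ^ 4) / 8
      * (1 / (4 * real (Suc k) ^ 2)) ^ m)
    sums (a_seq (2 * (m + 1) + 1) / 2 ^ (2 * m + 3) + a_seq (2 * (m + 1) + 2) / 2 ^ (2 * m + 4))"
    by (simp only: term_eq of_nat_0_less_iff zero_less_Suc)
  moreover have "2 * (m + 1) + 1 = 2 * m + 3" "2 * (m + 1) + 2 = 2 * m + 4" by simp_all
  ultimately show ?thesis by (simp only:)
qed

lemma a_seq_summable: "summable (\<lambda>n. a_seq n / 2 ^ n)"
proof -
  have "Bseq a_seq"
    using a_seq_tendsto_0 by (intro convergent_imp_Bseq convergentI)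
  then obtain C where C: "\<And>n. norm (a_seq n) \<le> C" using BseqE by blast
  show ?thesis
  proof (rule summable_comparison_test)
    show "summable (\<lambda>n. C * (1 / 2) ^ n)"
      by (intro summable_mult summable_geometric) simp
    show "\<exists>N. \<forall>n\<ge>N. norm (a_seq n / 2 ^ n) \<le> C * (1 / 2) ^ n"
      using C by (auto simp: abs_divide power_divide divide_right_mono)
  qed
qed

lemma a_seq_generating_sums: "(\<lambda>n. a_seq n / 2 ^ n) sums b_seq 0"
proof -
  define x where "x k = real (Suc k)" for k
  define s :: "nat \<Rightarrow> real" where "s k = (- 1) ^ k" for k
  have x: "1 \<le> x k" for k by (simp add: x_def)
  define g where "g k = (1 / x k ^ 5 + 1 / x k ^ 3 - 2 * s k / x k ^ 4) / 8" for k
  let ?p = "\<lambda>m. a_seq (2 * m + 3) / 2 ^ (2 * m + 3) + a_seq (2 * m + 4) / 2 ^ (2 * m + 4)"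
  \<comment> \<open>The claimed value is b_0 - a_0 - a_1 / 2 - a_2 / 4.\<close>
  have pairs: "?p sums (5 * ln 2 - 1 / 2 - pi - zeta 3 / 2 + dirichlet_eta 2)"
  proof (rule sums_geometric_swap)
    show "(\<lambda>k. g k * (1 / (4 * x k ^ 2)) ^ m) sums ?p m" for m
      using a_seq_pair_sums[of m] by (simp add: g_def x_def s_def)
    show "0 \<le> 1 / (4 * x k ^ 2)" for k by simp
    show "1 / (4 * x k ^ 2) \<le> 1 / 2" for k
    proof -
      have "1 \<le> x k ^ 2" using x by (rule one_le_power)
      then have "1 / (4 * x k ^ 2) \<le> 1 / 2" by (intro divide_left_mono) linarith+
      then show ?thesis .
    qed
    show "summable (\<lambda>k. \<bar>g k\<bar>)"
    proof (rule summable_comparison_test)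
      show "summable (\<lambda>k. 1 / real (Suc k) ^ 3)" by (rule summable_inverse_Suc_power) simp
      have "\<bar>g k\<bar> \<le> 1 / x k ^ 3" for k
      proof -
        have "1 / x k ^ 5 \<le> 1 / x k ^ 3" "1 / x k ^ 4 \<le> 1 / x k ^ 3"
          using x[of k] by (auto intro!: divide_left_mono power_increasing)
        moreover have "0 \<le> 1 / x k ^ 5" "0 \<le> 1 / x k ^ 4" using x[of k] by auto
        moreover have "\<bar>(u + v - 2 * e / w) / 8\<bar> \<le> v"
          if "u \<le> v" "1 / w \<le> v" "0 \<le> u" "0 \<le> 1 / w" "e = 1 \<or> e = - 1" for u v w e :: real
        proof -
          have "\<bar>(u + v - 2 * e * t) / 8\<bar> \<le> v" if "0 \<le> t" "t \<le> v" for t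
            using \<open>e = 1 \<or> e = - 1\<close> that \<open>u \<le> v\<close> \<open>0 \<le> u\<close> by auto
          from this[of "1 / w"] show ?thesis using that by simp
        qed
        moreover have "s k = 1 \<or> s k = - 1" by (cases "even k") (auto simp: s_def)
        ultimately show ?thesis unfolding g_def by blast
      qed
      then show "\<exists>N. \<forall>k\<ge>N. norm \<bar>g k\<bar> \<le> 1 / real (Suc k) ^ 3" by (auto simp: x_def)
    qed
    \<comment> \<open>Partial fractions in x = k + 1: differences of reciprocals giving ln 2, two
      Leibniz series giving pi, and the series of zeta(3) and eta(2).\<close>
    have split: "g k / (1 - 1 / (4 * x k ^ 2)) =
        5 / 2 * ((1 / (2 * x k - 1) - 1 / (2 * x k)) - (1 / (2 * x k) - 1 / (2 * x k + 1)))
        - 1 / 2 * (1 / x k ^ 3) - 2 * (s k / (2 * x k - 1) - s k / (2 * x k + 1)) + s k / x k ^ 2" for k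
    proof -
      define y where "y = x k"
      have "1 \<le> y" using x by (simp add: y_def)
      then have nz: "y \<noteq> 0" "2 * y - 1 \<noteq> 0" "2 * y + 1 \<noteq> 0" by auto
      have *: "1 - 1 / (4 * y ^ 2) = (2 * y - 1) * (2 * y + 1) / (4 * y ^ 2)"
        using nz by (simp add: field_simps power2_eq_square)
      have "(1 / y ^ 5 + 1 / y ^ 3 - 2 * s k / y ^ 4) / 8 / (1 - 1 / (4 * y ^ 2))
        = (1 + y ^ 2 - 2 * s k * y) / (2 * y ^ 3 * ((2 * y - 1) * (2 * y + 1)))"
        unfolding * using nz by (simp add: divide_simps eval_nat_numeral) (simp add: algebra_simps)
      also have "\<dots> = 5 / 2 * ((1 / (2 * y - 1) - 1 / (2 * y)) - (1 / (2 * y) - 1 / (2 * y + 1)))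
        - 1 / 2 * (1 / y ^ 3) - 2 * (s k / (2 * y - 1) - s k / (2 * y + 1)) + s k / y ^ 2"
        using nz by (simp add: divide_simps) (simp add: algebra_simps eval_nat_numeral)
      finally show ?thesis by (simp add: g_def y_def)
    qed
    have 1: "(\<lambda>k. 1 / (2 * x k - 1) - 1 / (2 * x k)) sums ln 2"
      using ln_2_sums_odd_even by (simp add: x_def algebra_simps)
    have 2: "(\<lambda>k. 1 / (2 * x k) - 1 / (2 * x k + 1)) sums (1 - ln 2)"
      using ln_2_sums_even_odd by (simp add: x_def algebra_simps)
    have 3: "(\<lambda>k. 1 / x k ^ 3) sums zeta 3"
      using zeta_sums[of 3] by (simp add: x_def)
    have 4: "(\<lambda>k. s k / x k ^ 2) sums dirichlet_eta 2"
      using eta_sums[of 2] by (simp add: x_def s_def)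
    have 5: "(\<lambda>k. s k / (2 * x k - 1)) sums (pi / 4)"
      using pi_4_sums by (simp add: x_def s_def algebra_simps)
    have 6: "(\<lambda>k. s k / (2 * x k + 1)) sums (1 - pi / 4)"
      using sums_minus[OF sums_shift_one[OF pi_4_sums]] by (simp add: x_def s_def algebra_simps)
    have "(\<lambda>k. g k / (1 - 1 / (4 * x k ^ 2))) sums (5 / 2 * (ln 2 - (1 - ln 2)) - 1 / 2 * zeta 3
        - 2 * (pi / 4 - (1 - pi / 4)) + dirichlet_eta 2)"
      unfolding split by (intro sums_add sums_diff sums_mult 1 2 3 4 5 6)
    then show "(\<lambda>k. g k / (1 - 1 / (4 * x k ^ 2))) sums
        (5 * ln 2 - 1 / 2 - pi - zeta 3 / 2 + dirichlet_eta 2)"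
      by (simp add: algebra_simps)
  qed
  let ?a = "\<lambda>n. a_seq n / 2 ^ n"
  \<comment> \<open>Convergence of the paired series alone would not give convergence of the
    original one; \<open>a_seq_summable\<close> supplies it, and pairing then identifies the
    sum.\<close>
  have "(\<lambda>n. ?a (n + 3)) sums (suminf ?a - (\<Sum>i<3. ?a i))"
    by (intro sums_split_initial_segment summable_sums a_seq_summable)
  from sums_pairs[OF this] have "?p sums (suminf ?a - (\<Sum>i<3. ?a i))"
    by (simp add: add_ac)
  then have "suminf ?a - (\<Sum>i<3. ?a i) = 5 * ln 2 - 1 / 2 - pi - zeta 3 / 2 + dirichlet_eta 2"
    using pairs by (rule sums_unique2)
  moreover have "(\<Sum>i<3. ?a i) = 1 / 2 - dirichlet_eta 2 + zeta 3 / 2"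
    by (simp add: eval_nat_numeral a_seq_def diff_divide_distrib)
  ultimately have "suminf ?a = b_seq 0"
    by (simp add: b_seq_def)
  then show ?thesis
    using a_seq_summable by (simp add: sums_iff)
qed

text \<open>Since the full series sums to b_0, A_n is its tail after index n, rescaled by
  2^(n+1).\<close>

lemma A_seq_sums: "(\<lambda>j. a_seq (n + 1 + j) / 2 ^ j) sums A_seq n"
proof -
  have "(\<lambda>j. 2 ^ (n + 1) * (a_seq (j + (n + 1)) / 2 ^ (j + (n + 1)))) sums
      (2 ^ (n + 1) * (b_seq 0 - (\<Sum>k<n + 1. a_seq k / 2 ^ k)))"
    by (intro sums_mult sums_split_initial_segment a_seq_generating_sums)
  moreover have "2 ^ (n + 1) * (a_seq (j + (n + 1)) / 2 ^ (j + (n + 1))) = a_seq (n + 1 + j) / 2 ^ j" for j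
    by (simp add: power_add add_ac)
  moreover have "{..<n + 1} = {0..n}" by auto
  ultimately show ?thesis by (simp only: A_seq_def)
qed

lemma A_seq_rec: "A_seq n = a_seq (n + 1) + A_seq (n + 1) / 2"
  by (simp add: A_seq_def field_simps)

lemma A_seq_pair_sums:
  "(\<lambda>j. (a_seq (n + 1 + 2 * j) + a_seq (n + 2 + 2 * j) / 2) / 4 ^ j) sums A_seq n"
  using sums_pairs[OF A_seq_sums[of n]] by (simp add: power_mult add_divide_distrib add_ac)

lemma A_seq_even_pos:
  assumes "1 \<le> n"
  shows "0 < A_seq (2 * n)"
proof (rule sums_less[OF sums_zero A_seq_pair_sums, where i = 0])
  have *: "0 < (a_seq (2 * n + 1 + 2 * j) + a_seq (2 * n + 2 + 2 * j) / 2) / 4 ^ j" for j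
    using a_seq_pair_sign(1)[of "n + j"] assms by (simp add: algebra_simps)
  show "0 \<le> (a_seq (2 * n + 1 + 2 * j) + a_seq (2 * n + 2 + 2 * j) / 2) / 4 ^ j" for j
    using *[of j] by simp
  show "0 < (a_seq (2 * n + 1 + 2 * 0) + a_seq (2 * n + 2 + 2 * 0) / 2) / 4 ^ 0"
    by (rule *)
qed

lemma A_seq_odd_neg:
  assumes "1 \<le> n"
  shows "A_seq (2 * n + 1) < 0"
proof (rule sums_less[OF A_seq_pair_sums sums_zero, where i = 0])
  have *: "(a_seq (2 * n + 1 + 1 + 2 * j) + a_seq (2 * n + 1 + 2 + 2 * j) / 2) / 4 ^ j < 0" for j
    using a_seq_pair_sign(2)[of "n + j"] assms
    by (intro divide_neg_pos) (simp_all add: algebra_simps numeral_3_eq_3)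
  show "(a_seq (2 * n + 1 + 1 + 2 * j) + a_seq (2 * n + 1 + 2 + 2 * j) / 2) / 4 ^ j \<le> 0" for j
    using *[of j] by simp
  show "(a_seq (2 * n + 1 + 1 + 2 * 0) + a_seq (2 * n + 1 + 2 + 2 * 0) / 2) / 4 ^ 0 < 0"
    by (rule *)
qed

text \<open>Unrolling the recursion once leaves A_{2n+1} / 2 < 0 as remainder and gives the upper
  bound; unrolling it twice leaves A_{2n+2} / 4 > 0 and gives the lower one.\<close>

lemma A_seq_even_bounds:
  assumes "1 \<le> n"
  shows "a_seq (2 * n + 1) + 1 / 2 * a_seq (2 * n + 2) < A_seq (2 * n)"
    and "A_seq (2 * n) < a_seq (2 * n + 1)"
  using A_seq_rec[of "2 * n"] A_seq_rec[of "2 * n + 1"] A_seq_odd_neg[OF assms]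
    A_seq_even_pos[of "n + 1"] by (simp_all add: field_simps)

lemma A_seq_odd_bounds:
  assumes "1 \<le> n"
  shows "A_seq (2 * n + 1) < a_seq (2 * n + 2) + 1 / 2 * a_seq (2 * n + 3)"
    and "a_seq (2 * n + 2) < A_seq (2 * n + 1)"
  using A_seq_rec[of "2 * n + 1"] A_seq_rec[of "2 * n + 2"] A_seq_odd_neg[of "n + 1"]
    A_seq_even_pos[of "n + 1"] by (simp_all add: field_simps numeral_3_eq_3)

text \<open>The bounds on A_{2n+2} and A_{2n} leave only a_{2n+3} < a_{2n+1} + a_{2n+2} / 2 to show,
  which is the two-step gap at the odd index 2n + 1.\<close>

lemma A_seq_even_antimono: "strict_antimono_on {1..} (\<lambda>n. A_seq (2 * n))"
proof (rule strict_antimono_on_atLeast_Suc)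
  fix n :: nat
  assume n: "1 \<le> n"
  have "A_seq (2 * Suc n) < a_seq (2 * n + 3)"
    using A_seq_even_bounds(2)[of "Suc n"] by (simp add: numeral_3_eq_3)
  also have "\<dots> < a_seq (2 * n + 1) + 1 / 2 * a_seq (2 * n + 2)"
    using abs_a_seq_two_step_gap[of "2 * n + 1"] n abs_a_seq_odd[of n] abs_a_seq_odd'[of n] abs_a_seq_even[of n]
    by (simp add: numeral_3_eq_3)
  also have "\<dots> < A_seq (2 * n)"
    by (rule A_seq_even_bounds(1)[OF n])
  finally show "A_seq (2 * Suc n) < A_seq (2 * n)" .
qed

text \<open>Mirror image of the even case, with the two-step gap at 2n + 2; negation makes the lemma
  on decreasing sequences applicable.\<close>

lemma A_seq_odd_mono: "strict_mono_on {1..} (\<lambda>n. A_seq (2 * n + 1))"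
proof -
  have "strict_antimono_on {1..} (\<lambda>n. - A_seq (2 * n + 1))"
  proof (rule strict_antimono_on_atLeast_Suc)
    fix n :: nat
    assume n: "1 \<le> n"
    have "A_seq (2 * n + 1) < a_seq (2 * n + 2) + 1 / 2 * a_seq (2 * n + 3)"
      by (rule A_seq_odd_bounds(1)[OF n])
    also have "\<dots> < a_seq (2 * (n + 1) + 2)"
      using abs_a_seq_two_step_gap[of "2 * n + 2"] n abs_a_seq_even[of n] abs_a_seq_odd'[of n]
        abs_a_seq_even[of "n + 1"]
      by (simp add: numeral_3_eq_3)
    also have "\<dots> < A_seq (2 * (n + 1) + 1)"
      by (rule A_seq_odd_bounds(2)) simp
    finally show "- A_seq (2 * Suc n + 1) < - A_seq (2 * n + 1)" by simp
  qed
  then show ?thesis by (auto simp: monotone_on_def)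
qed

text \<open>For n >= 2 the bounds enclose A_n between 0 and a_{n+1}, and a_n tends to 0.\<close>

lemma A_seq_tendsto_0: "A_seq \<longlonglongrightarrow> 0"
proof (rule Lim_null_comparison)
  show "(\<lambda>n. \<bar>a_seq (n + 1)\<bar>) \<longlonglongrightarrow> 0"
    using a_seq_tendsto_0 by (intro tendsto_rabs_zero LIMSEQ_ignore_initial_segment)
  have "norm (A_seq n) \<le> \<bar>a_seq (n + 1)\<bar>" if "2 \<le> n" for n
  proof -
    have "3 \<le> n + 1" using that by simp
    then show ?thesis
    proof (cases rule: odd_even_from_3_cases)
      case (1 m)
      then show ?thesis using A_seq_even_pos[of m] A_seq_even_bounds[of m] by simp
    next
      case (2 m)
      then have "n = 2 * m + 1" by simp
      then show ?thesis using 2 A_seq_odd_neg[of m] A_seq_odd_bounds[of m] by simp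
    qed
  qed
  then show "\<forall>\<^sub>F n in sequentially. norm (A_seq n) \<le> \<bar>a_seq (n + 1)\<bar>"
    by (rule eventually_mono[OF eventually_ge_at_top])
qed

text \<open>The dotted chain of part (3) is expressed by its links for k in {2..n}; the link for k =
  2 ends at a_3, where the last two inequalities take over.\<close>

theorem corollary4p1:
  fixes \<mu> :: real
  defines "\<mu> \<equiv> 65 / 108"
  shows
    "(\<forall>n. c_seq n < b_seq (n + 1))
     \<and>
     (strict_mono_on {1..} (\<lambda>n. A_seq (2 * n + 1))
      \<and> strict_antimono_on {1..} (\<lambda>n. A_seq (2 * n))
      \<and> A_seq \<longlonglongrightarrow> 0
      \<and> (\<forall>n\<ge>1. a_seq (2 * n + 2) < A_seq (2 * n + 1)
             \<and> A_seq (2 * n + 1) < 0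
             \<and> 0 < a_seq (2 * n + 1) + 1 / 2 * a_seq (2 * n + 2)
             \<and> a_seq (2 * n + 1) + 1 / 2 * a_seq (2 * n + 2) < A_seq (2 * n)
             \<and> A_seq (2 * n) < a_seq (2 * n + 1)))
     \<and>
     (strict_antimono_on {2..} (\<lambda>n. \<bar>a_seq n\<bar>)
      \<and> a_seq \<longlonglongrightarrow> 0
      \<and> (\<forall>n\<ge>2. 0 < - a_seq (2 * n + 2)
             \<and> - a_seq (2 * n + 2) < a_seq (2 * n + 1)
             \<and> (\<forall>k\<in>{2..n}. a_seq (2 * k + 1) < - a_seq (2 * k)
                           \<and> - a_seq (2 * k) < a_seq (2 * k - 1))
             \<and> a_seq 3 < a_seq 2
             \<and> a_seq 2 < - a_seq 1)
      \<and> (\<forall>n\<ge>2. (1 - (1 - \<mu>) / (2 ^ (n - 1) - \<mu>)) * zeta n < zeta (n + 1)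
             \<and> zeta (n + 1) < (zeta n + 1) / 2
             \<and> (zeta n + 1) / 2 < zeta n))"
proof -
  have sign: "0 < - a_seq (2 * n + 2)" "- a_seq (2 * n + 2) < a_seq (2 * n + 1)" if "1 \<le> n" for n
    using a_seq_even_neg[OF that] a_seq_even_less_odd[OF that] by simp_all
  have down: "a_seq (2 * k + 1) < - a_seq (2 * k) \<and> - a_seq (2 * k) < a_seq (2 * k - 1)"
    if "2 \<le> k" for k
  proof -
    \<comment> \<open>Writing k = m + 1 removes the subtraction in \<open>2 * k - 1\<close> and
      matches the indices of \<open>a_seq_halving\<close>.\<close>
    have "k = k - 1 + 1" "1 \<le> k - 1" using that by simp_all
    then obtain m where m: "k = m + 1" "1 \<le> m" by blast
    have "a_seq (2 * m + 3) < - a_seq (2 * m + 2)"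
      using a_seq_halving[OF m(2)] a_seq_even_neg[OF m(2)] by linarith
    then show ?thesis
      using sign(2)[OF m(2)] by (simp add: m(1) numeral_3_eq_3)
  qed
  have pair: "0 < a_seq (2 * n + 1) + 1 / 2 * a_seq (2 * n + 2)" if "1 \<le> n" for n
    using a_seq_pair_sign(1)[OF that] by simp
  have zeta_mid: "(zeta n + 1) / 2 < zeta n" if "2 \<le> n" for n
    using zeta_gt_1[OF that] by simp
  have three: "\<forall>n\<ge>2. 0 < - a_seq (2 * n + 2)
             \<and> - a_seq (2 * n + 2) < a_seq (2 * n + 1)
             \<and> (\<forall>k\<in>{2..n}. a_seq (2 * k + 1) < - a_seq (2 * k)
                           \<and> - a_seq (2 * k) < a_seq (2 * k - 1))
             \<and> a_seq 3 < a_seq 2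
             \<and> a_seq 2 < - a_seq 1"
  proof (intro allI impI)
    fix n :: nat
    assume "2 \<le> n"
    then have "1 \<le> n" by simp
    have "\<forall>k\<in>{2..n}. a_seq (2 * k + 1) < - a_seq (2 * k) \<and> - a_seq (2 * k) < a_seq (2 * k - 1)"
      using down by simp
    then show "0 < - a_seq (2 * n + 2)
             \<and> - a_seq (2 * n + 2) < a_seq (2 * n + 1)
             \<and> (\<forall>k\<in>{2..n}. a_seq (2 * k + 1) < - a_seq (2 * k)
                           \<and> - a_seq (2 * k) < a_seq (2 * k - 1))
             \<and> a_seq 3 < a_seq 2
             \<and> a_seq 2 < - a_seq 1"
      using sign[OF \<open>1 \<le> n\<close>] a_seq_3_less_2 a_seq_2_less_1 by blast
  qed
  show ?thesis
    unfolding \<mu>_def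
  proof (intro conjI)
    show "\<forall>n. c_seq n < b_seq (n + 1)"
      using c_seq_less_b_seq by blast
    show "\<forall>n\<ge>1. a_seq (2 * n + 2) < A_seq (2 * n + 1)
             \<and> A_seq (2 * n + 1) < 0
             \<and> 0 < a_seq (2 * n + 1) + 1 / 2 * a_seq (2 * n + 2)
             \<and> a_seq (2 * n + 1) + 1 / 2 * a_seq (2 * n + 2) < A_seq (2 * n)
             \<and> A_seq (2 * n) < a_seq (2 * n + 1)"
      using A_seq_odd_bounds(2) A_seq_odd_neg pair A_seq_even_bounds by blast
    show "\<forall>n\<ge>2. (1 - (1 - 65 / 108) / (2 ^ (n - 1) - 65 / 108)) * zeta n < zeta (n + 1)
             \<and> zeta (n + 1) < (zeta n + 1) / 2
             \<and> (zeta n + 1) / 2 < zeta n"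
      using zeta_Suc_greater zeta_Suc_less zeta_mid by blast
  qed (fact A_seq_odd_mono A_seq_even_antimono A_seq_tendsto_0 abs_a_seq_antimono a_seq_tendsto_0 three)+
qed

end
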